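(* Let $k \geq 2$ be an integer and let $T_1, \ldots, T_k$ be lower bound trees for the radio number (i.e. $T_i \in \mathcal{T}_{lb}$ for $1 \leq i \leq k$), where each $T_i$ has order $n_i$, diameter $d_i$ and exactly one weight center $w_i$. Let $T_{w_k}$ be the tree obtained from the disjoint union of $T_1, \ldots, T_k$ by identifying the weight centers $w_1, \ldots, w_k$ into a single vertex $w$, and let $d = \mathrm{diam}(T_{w_k})$. Then $T_{w_k} \in \mathcal{T}_{lb}$ and $$\mathrm{rn}(T_{w_k}) = \sum_{i=1}^{k} \bigl(\mathrm{rn}(T_i) + (n_i - 1)(d - d_i)\bigr) - k + 1.$$
   Context: All graphs are finite, simple and connected. $d_G(u,v)$ denotes graph distance and $\mathrm{diam}(G)$ the diameter. A radio labeling of a graph $G$ is a map $f : V(G) \to \{0,1,2,\ldots\}$ such that $|f(u)-f(v)| \geq \mathrm{diam}(G) + 1 - d_G(u,v)$ for every pair of distinct vertices $u,v$. Its span is $\max\{f(v) : v \in V(G)\}$. The radio number $\mathrm{rn}(G)$ is the minimum span over all radio labelings of $G$. For a tree $T$ and $v \in V(T)$, put $w_T(v) = \sum_{u \in V(T)} d_T(u,v)$. A weight center of $T$ is a vertex minimizing $w_T$; $W(T)$ denotes the set of weight centers, and it consists of either one vertex or two adjacent vertices. Put $\varepsilon(T) = 1$ if $|W(T)| = 1$ and $\varepsilon(T) = 0$ if $|W(T)| = 2$. The level of $u \in V(T)$ is $L_T(u) = \min\{d_T(u,x) : x \in W(T)\}$ and the total level of $T$ is $L(T) = \sum_{u \in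 V(T)} L_T(u)$. For a tree $T$ of order $n$ and diameter $d \geq 2$, define $lb(T) = (n-1)(d + \varepsilon(T)) - 2L(T) + \varepsilon(T)$ (this is a known lower bound for $\mathrm{rn}(T)$). $T$ is called a lower bound tree if $\mathrm{rn}(T) = lb(T)$; $\mathcal{T}_{lb}$ denotes the set of all lower bound trees (of diameter at least 2). *)

theory Defs
  imports "Graph_Theory.Digraph_Component"
begin

text \<open>
  Finite simple graphs are rendered by the locale predicate \<^const>\<open>pair_graph\<close>: an edge uv is
  the pair of arcs (u,v) and (v,u).
\<close>

text \<open>
  The constants \<^const>\<open>forest\<close> and \<^const>\<open>tree\<close> are meant for directed graphs: in a symmetric
  digraph every edge yields a (directed) cycle of length 2, so they would exclude every graph with
  an edge. An undirected cycle is a cycle with at least three arcs.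
\<close>

definition graph_tree :: "'a pair_pre_digraph \<Rightarrow> bool" where
  "graph_tree G \<longleftrightarrow>
     pair_graph G \<and> connected (with_proj G) \<and>
     \<not> (\<exists>p. pre_digraph.cycle (with_proj G) p \<and> 3 \<le> length p)"

definition gdist :: "'a pair_pre_digraph \<Rightarrow> 'a \<Rightarrow> 'a \<Rightarrow> nat" where
  "gdist G u v = (LEAST m. \<exists>p. pre_digraph.awalk (with_proj G) u p v \<and> length p = m)"

definition diam :: "'a pair_pre_digraph \<Rightarrow> nat" where
  "diam G = Max {gdist G u v |u v. u \<in> pverts G \<and> v \<in> pverts G}"

text \<open>
  A labeling is a total function of which only the values on the vertices matter. The radio
  condition is written with integers, as subtraction on naturals would truncate.
\<close>

definition radio_labeling :: "'a pair_pre_digraph \<Rightarrow> ('a \<Rightarrow> nat) \<Rightarrow> bool" where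
  "radio_labeling G f \<longleftrightarrow>
     (\<forall>u \<in> pverts G. \<forall>v \<in> pverts G. u \<noteq> v \<longrightarrow>
        \<bar>int (f u) - int (f v)\<bar> \<ge> int (diam G) + 1 - int (gdist G u v))"

definition span_of :: "'a pair_pre_digraph \<Rightarrow> ('a \<Rightarrow> nat) \<Rightarrow> nat" where
  "span_of G f = Max (f ` pverts G)"

definition rn :: "'a pair_pre_digraph \<Rightarrow> nat" where
  "rn G = (LEAST s. \<exists>f. radio_labeling G f \<and> span_of G f = s)"

definition weight :: "'a pair_pre_digraph \<Rightarrow> 'a \<Rightarrow> nat" where
  "weight G v = (\<Sum>u \<in> pverts G. gdist G u v)"

definition weight_centers :: "'a pair_pre_digraph \<Rightarrow> 'a set" where
  "weight_centers G = {v \<in> pverts G. \<forall>u \<in> pverts G. weight G v \<le> weight G u}"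

text \<open>For trees, the second case is that of two (adjacent) weight centers.\<close>

definition eps :: "'a pair_pre_digraph \<Rightarrow> nat" where
  "eps G = (if card (weight_centers G) = 1 then 1 else 0)"

definition level :: "'a pair_pre_digraph \<Rightarrow> 'a \<Rightarrow> nat" where
  "level G u = Min (gdist G u ` weight_centers G)"

definition total_level :: "'a pair_pre_digraph \<Rightarrow> nat" where
  "total_level G = (\<Sum>u \<in> pverts G. level G u)"

definition lb :: "'a pair_pre_digraph \<Rightarrow> int" where
  "lb G = (int (card (pverts G)) - 1) * (int (diam G) + int (eps G))
          - 2 * int (total_level G) + int (eps G)"

definition lower_bound_trees :: "'a pair_pre_digraph set" where
  "lower_bound_trees = {G. graph_tree G \<and> 2 \<le> diam G \<and> int (rn G) = lb G}"

text \<open>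
  \<open>glue k T w\<close> is the disjoint union of \<open>T 1, \<dots>, T k\<close> with the vertices \<open>w 1, \<dots>, w k\<close>
  identified: \<^const>\<open>None\<close> is the identified vertex, and \<open>Some (i, v)\<close> is the copy of any other
  vertex \<open>v\<close> of \<open>T i\<close>. Because of the tag \<open>i\<close> the graphs \<open>T i\<close> themselves need not be disjoint.
\<close>

definition glue_vertex :: "(nat \<Rightarrow> 'a) \<Rightarrow> nat \<Rightarrow> 'a \<Rightarrow> (nat \<times> 'a) option" where
  "glue_vertex w i v = (if v = w i then None else Some (i, v))"

definition glue ::
  "nat \<Rightarrow> (nat \<Rightarrow> 'a pair_pre_digraph) \<Rightarrow> (nat \<Rightarrow> 'a) \<Rightarrow> (nat \<times> 'a) option pair_pre_digraph" where
  "glue k T w =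
     \<lparr> pverts = (\<Union>i \<in> {1..k}. glue_vertex w i ` pverts (T i)),
       parcs = (\<Union>i \<in> {1..k}. map_prod (glue_vertex w i) (glue_vertex w i) ` parcs (T i)) \<rparr>"

end

theory Submission
  imports Defs
begin

text \<open>
  Let \<open>T\<close> have a unique weight center \<open>w\<close>. List the vertices by increasing label; since
  \<open>d(u,v) \<le> L(u) + L(v)\<close>, consecutive labels differ by at least \<open>diam T + 1 - L(u) - L(v)\<close>. Summing
  gives the lower bound, and equality forces the first and last vertex to have levels 0 and 1;
  after reflecting the labeling, \<open>w\<close> comes first and a neighbor of \<open>w\<close> comes last.

  In the glued tree, use the order that lists \<open>w\<close>, then the other vertices of \<open>T 1\<close> in the order
  of an optimal labeling, then those of \<open>T 2\<close>, and so on, with all gaps computed from the new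
  diameter. Vertices of the same \<open>T i\<close> are then separated since they were so in \<open>T i\<close>. For \<open>u\<close> in
  \<open>T i\<close> and \<open>v\<close> in a later \<open>T j\<close>, compare \<open>u\<close> with the last vertex of \<open>T i\<close> and \<open>v\<close> with the
  center of \<open>T j\<close>. The span of this labeling is the lower bound of the glued tree.
\<close>

section \<open>Distances in connected graphs\<close>

locale conn_graph = pair_graph G for G :: "'a pair_pre_digraph" +
  assumes conn: "connected (with_proj G)"
begin

lemma sym_parcs: "sym (parcs G)"
  using pair_sym_arcs by (simp add: symmetric_def)

text \<open>Trades lists of arcs for powers of the arc relation, where splitting and reversing walks
  is easy. The vertex hypothesis matters at \<open>m = 0\<close>: an empty walk must sit at a
  vertex.\<close>

lemma awalk_relpow:
  "u \<in> pverts G \<Longrightarrow> (\<exists>p. awalk u p v \<and> length p = m) \<longleftrightarrow> (u, v) \<in> parcs G ^^ m"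
proof (induction m arbitrary: u)
  case 0
  then show ?case by (auto simp: awalk_Nil_iff)
next
  case (Suc m)
  have "(\<exists>p. awalk u p v \<and> length p = Suc m) \<longleftrightarrow>
        (\<exists>x. (u, x) \<in> parcs G \<and> (\<exists>p. awalk x p v \<and> length p = m))"
  proof
    assume "\<exists>p. awalk u p v \<and> length p = Suc m"
    then obtain e p where "awalk u (e # p) v" "length p = m" by (auto simp: length_Suc_conv)
    then show "\<exists>x. (u, x) \<in> parcs G \<and> (\<exists>p. awalk x p v \<and> length p = m)"
      by (intro exI[of _ "snd e"]) (auto simp: awalk_Cons_iff)
  next
    assume "\<exists>x. (u, x) \<in> parcs G \<and> (\<exists>p. awalk x p v \<and> length p = m)"
    then obtain x p where "(u, x) \<in> parcs G" "awalk x p v" "length p = m" by blast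
    then have "awalk u ((u, x) # p) v \<and> length ((u, x) # p) = Suc m" by (simp add: awalk_Cons_iff)
    then show "\<exists>p. awalk u p v \<and> length p = Suc m" by blast
  qed
  also have "\<dots> \<longleftrightarrow> (\<exists>x. (u, x) \<in> parcs G \<and> (x, v) \<in> parcs G ^^ m)"
    using Suc.IH in_arcsD2 by blast
  also have "\<dots> \<longleftrightarrow> (u, v) \<in> parcs G ^^ Suc m"
    by (meson relpow_Suc_E2 relpow_Suc_I2)
  finally show ?case .
qed

lemma gdist_relpow: "u \<in> pverts G \<Longrightarrow> gdist G u v = (LEAST m. (u, v) \<in> parcs G ^^ m)"
  by (simp add: gdist_def awalk_relpow)

lemma gdist_le: "u \<in> pverts G \<Longrightarrow> (u, v) \<in> parcs G ^^ m \<Longrightarrow> gdist G u v \<le> m"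
  by (simp add: gdist_relpow Least_le)

text \<open>Connectivity makes the set under \<open>LEAST\<close> nonempty; since arcs are symmetric
  it already gives directed reachability.\<close>

lemma relpow_gdist:
  assumes "u \<in> pverts G" "v \<in> pverts G"
  shows "(u, v) \<in> parcs G ^^ gdist G u v"
proof -
  have "strongly_connected (with_proj G)"
    using symmetric_connected_imp_strongly_connected conn pair_sym_arcs by blast
  then have "u \<rightarrow>\<^sup>*\<^bsub>with_proj G\<^esub> v"
    using assms by (simp add: strongly_connected_def)
  then obtain p where "awalk u p v"
    unfolding reachable_awalk by blast
  then have "(u, v) \<in> parcs G ^^ length p"
    using awalk_relpow assms by blast
  then show ?thesis
    unfolding gdist_relpow[OF assms(1)] by (rule LeastI)
qed

lemma gdist_refl [simp]: "u \<in> pverts G \<Longrightarrow> gdist G u u = 0"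
  using gdist_le[of u u 0] by simp

lemma gdist_eq_0_iff: "u \<in> pverts G \<Longrightarrow> v \<in> pverts G \<Longrightarrow> gdist G u v = 0 \<longleftrightarrow> u = v"
  using relpow_gdist[of u v] by auto

lemma gdist_arc: "(u, v) \<in> parcs G \<Longrightarrow> gdist G u v \<le> 1"
  using gdist_le[of u v 1] in_arcsD1 by simp

lemma gdist_triangle:
  assumes "u \<in> pverts G" "v \<in> pverts G" "x \<in> pverts G"
  shows "gdist G u x \<le> gdist G u v + gdist G v x"
  using assms relpow_gdist[of u v] relpow_gdist[of v x]
  by (intro gdist_le) (auto simp: relpow_add)

lemma relpow_sym: "(u, v) \<in> parcs G ^^ m \<Longrightarrow> (v, u) \<in> parcs G ^^ m"
proof (induction m arbitrary: v)
  case (Suc m)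
  then show ?case
    using sym_parcs by (meson relpow_Suc_E relpow_Suc_I2 symD)
qed simp

lemma gdist_commute: "u \<in> pverts G \<Longrightarrow> v \<in> pverts G \<Longrightarrow> gdist G u v = gdist G v u"
  by (meson gdist_le le_antisym relpow_gdist relpow_sym)

lemma gdist_arc_step:
  assumes "(y, z) \<in> parcs G" "u \<in> pverts G"
  shows "gdist G u z \<le> Suc (gdist G u y)"
  using gdist_triangle[of u y z] gdist_arc[OF assms(1)] assms in_arcsD1 in_arcsD2 by fastforce

text \<open>Each arc of a shortest walk raises \<open>\<phi>\<close> by at most 1. This bounds
  distances from below without analysing walks.\<close>

lemma potential_le_gdist:
  assumes "u \<in> pverts G" "v \<in> pverts G" "\<phi> u = (0::nat)"
    and "\<And>y z. (y, z) \<in> parcs G \<Longrightarrow> \<phi> z \<le> Suc (\<phi> y)"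
  shows "\<phi> v \<le> gdist G u v"
proof -
  have "(u, v) \<in> parcs G ^^ m \<Longrightarrow> \<phi> v \<le> m" for m v
  proof (induction m arbitrary: v)
    case (Suc m)
    then show ?case
      using assms(4) by (meson Suc_le_mono le_trans relpow_Suc_E)
  qed (use assms in simp)
  then show ?thesis
    using relpow_gdist assms by blast
qed

section \<open>The diameter\<close>

lemma finite_gdists: "finite {gdist G u v |u v. u \<in> pverts G \<and> v \<in> pverts G}"
proof -
  have "{gdist G u v |u v. u \<in> pverts G \<and> v \<in> pverts G} =
        case_prod (gdist G) ` (pverts G \<times> pverts G)" by auto
  then show ?thesis using pair_finite_verts by simp
qed

lemma gdist_le_diam: "u \<in> pverts G \<Longrightarrow> v \<in> pverts G \<Longrightarrow> gdist G u v \<le> diam G"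
  unfolding diam_def using finite_gdists by (intro Max_ge) auto

lemma pverts_nonempty: "pverts G \<noteq> {}"
  using conn by (simp add: connected_conv)

lemma diam_attained:
  obtains u v where "u \<in> pverts G" "v \<in> pverts G" "gdist G u v = diam G"
proof -
  have "diam G \<in> {gdist G u v |u v. u \<in> pverts G \<and> v \<in> pverts G}"
    unfolding diam_def using finite_gdists pverts_nonempty by (intro Max_in) auto
  then show ?thesis using that by auto
qed

lemma card_ge_2:
  assumes "0 < diam G"
  shows "2 \<le> card (pverts G)"
proof -
  obtain u v where "u \<in> pverts G" "v \<in> pverts G" "u \<noteq> v"
    using diam_attained assms by (metis gdist_refl less_irrefl)
  then show ?thesis
    using card_mono[OF pair_finite_verts, of "{u, v}"] by simp
qed

end

lemma graph_tree_conn_graph: "graph_tree G \<Longrightarrow> conn_graph G"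
  by (simp add: graph_tree_def conn_graph_def conn_graph_axioms_def)

section \<open>The lower bound and optimal labelings\<close>

text \<open>
  Adding up the separation of consecutive elements in increasing order of \<open>f\<close>, each \<open>L u\<close> is
  subtracted twice except at the two ends.
\<close>

lemma separated_range:
  fixes f :: "'a \<Rightarrow> nat" and L :: "'a \<Rightarrow> nat" and D :: int
  assumes "finite S" "S \<noteq> {}"
    and "\<And>u v. u \<in> S \<Longrightarrow> v \<in> S \<Longrightarrow> u \<noteq> v \<Longrightarrow> f u \<le> f v \<Longrightarrow>
           int (f v) - int (f u) \<ge> D - int (L u) - int (L v)"
  shows "\<exists>x\<in>S. \<exists>y\<in>S. (\<forall>z\<in>S. f x \<le> f z \<and> f z \<le> f y) \<and> (2 \<le> card S \<longrightarrow> x \<noteq> y) \<and>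
     int (f y) - int (f x) \<ge>
       (int (card S) - 1) * D - 2 * (\<Sum>u\<in>S. int (L u)) + int (L x) + int (L y)"
  using assms
proof (induction S rule: finite_ranking_induct[where f = f])
  case empty
  then show ?case by simp
next
  case (insert z S)
  show ?case
  proof (cases "S = {} \<or> z \<in> S")
    case True
    show ?thesis
    proof (cases "S = {}")
      case True
      then show ?thesis by simp
    next
      case False
      with True have "z \<in> S" by simp
      then have "insert z S = S" by auto
      then show ?thesis using insert False by simp
    qed
  next
    case False
    then obtain x y where xy: "x \<in> S" "y \<in> S" "\<forall>z\<in>S. f x \<le> f z \<and> f z \<le> f y"
      "int (f y) - int (f x) \<ge>
       (int (card S) - 1) * D - 2 * (\<Sum>u\<in>S. int (L u)) + int (L x) + int (L y)"
      using insert.IH insert.prems by force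
    have zy: "int (f z) - int (f y) \<ge> D - int (L y) - int (L z)"
      using insert.prems(2)[of y z] insert.hyps(2) xy(2) False by auto
    have "int (f z) - int (f x) \<ge> (int (card (insert z S)) - 1) * D
        - 2 * (\<Sum>u\<in>insert z S. int (L u)) + int (L x) + int (L z)"
      using zy xy(4) insert.hyps(1) False by (simp add: algebra_simps)
    moreover have "\<forall>v\<in>insert z S. f x \<le> f v \<and> f v \<le> f z"
      using xy insert.hyps(2) by force
    moreover have "x \<noteq> z" using False xy(1) by auto
    ultimately show ?thesis
      using xy(1) by blast
  qed
qed

lemma lb_unique_center:
  assumes "weight_centers G = {c}"
  shows "lb G = (int (card (pverts G)) - 1) * (int (diam G) + 1)
       - 2 * (\<Sum>u\<in>pverts G. int (gdist G u c)) + 1"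
  using assms by (simp add: lb_def eps_def total_level_def level_def)

lemma rn_eqI:
  assumes "radio_labeling G f" "span_of G f = s"
    and "\<And>g. radio_labeling G g \<Longrightarrow> s \<le> span_of G g"
  shows "rn G = s"
  unfolding rn_def using assms by (intro Least_equality) auto

context conn_graph
begin

lemma radio_labelingD:
  assumes "radio_labeling G f" "u \<in> pverts G" "v \<in> pverts G" "u \<noteq> v" "f u \<le> f v"
  shows "int (f v) - int (f u) \<ge> int (diam G) + 1 - int (gdist G u v)"
  using assms unfolding radio_labeling_def by (smt (verit) of_nat_le_iff)

text \<open>The triangle inequality through \<open>c\<close> reduces the radio condition to
  \<open>separated_range\<close> with \<open>D = diam G + 1\<close>. The \<open>- 1\<close> removes
  the final summand \<open>eps G = 1\<close> of \<open>lb G\<close>.\<close>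

lemma radio_labeling_ends:
  assumes f: "radio_labeling G f" and c: "weight_centers G = {c}" and pos: "0 < diam G"
  obtains x y where "x \<in> pverts G" "y \<in> pverts G" "x \<noteq> y"
    "\<And>z. z \<in> pverts G \<Longrightarrow> f x \<le> f z \<and> f z \<le> f y"
    "int (f y) - int (f x) \<ge> lb G - 1 + int (gdist G x c) + int (gdist G y c)"
proof -
  have cV: "c \<in> pverts G" using c by (auto simp: weight_centers_def)
  have sep: "int (f v) - int (f u) \<ge> (int (diam G) + 1) - int (gdist G u c) - int (gdist G v c)"
    if "u \<in> pverts G" "v \<in> pverts G" "u \<noteq> v" "f u \<le> f v" for u v
  proof -
    have "int (f v) - int (f u) \<ge> int (diam G) + 1 - int (gdist G u v)"
      using radio_labelingD f that by blast
    then show ?thesis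
      using gdist_triangle[of u c v] gdist_commute[of v c] that cV by linarith
  qed
  have "\<exists>x\<in>pverts G. \<exists>y\<in>pverts G.
    (\<forall>z\<in>pverts G. f x \<le> f z \<and> f z \<le> f y) \<and> (2 \<le> card (pverts G) \<longrightarrow> x \<noteq> y) \<and>
    int (f y) - int (f x) \<ge> (int (card (pverts G)) - 1) * (int (diam G) + 1)
       - 2 * (\<Sum>u\<in>pverts G. int (gdist G u c)) + int (gdist G x c) + int (gdist G y c)"
    by (rule separated_range[where L = "\<lambda>u. gdist G u c"])
      (use pair_finite_verts pverts_nonempty sep in auto)
  then obtain x y where xy: "x \<in> pverts G" "y \<in> pverts G"
    "\<forall>z\<in>pverts G. f x \<le> f z \<and> f z \<le> f y" "2 \<le> card (pverts G) \<longrightarrow> x \<noteq> y"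
    "int (f y) - int (f x) \<ge> (int (card (pverts G)) - 1) * (int (diam G) + 1)
       - 2 * (\<Sum>u\<in>pverts G. int (gdist G u c)) + int (gdist G x c) + int (gdist G y c)"
    by (elim bexE conjE) (rule that)
  have "int (f y) - int (f x) \<ge> lb G - 1 + int (gdist G x c) + int (gdist G y c)"
    using xy(5) by (simp add: lb_unique_center[OF c])
  then show ?thesis
    using that[of x y] xy card_ge_2[OF pos] by simp
qed

lemma radio_labeling_le_span: "v \<in> pverts G \<Longrightarrow> f v \<le> span_of G f"
  using pair_finite_verts by (simp add: span_of_def)

lemma span_eqI:
  assumes "x \<in> pverts G" "\<And>v. v \<in> pverts G \<Longrightarrow> f v \<le> f x"
  shows "span_of G f = f x"
  unfolding span_of_def using assms pair_finite_verts by (intro Max_eqI) auto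

text \<open>Two distinct ends cannot both be the center, so their levels add at least 1 and make up
  for the \<open>- 1\<close>.\<close>

lemma lb_le_span:
  assumes "radio_labeling G f" "weight_centers G = {c}" "0 < diam G"
  shows "lb G \<le> int (span_of G f)"
proof -
  have cV: "c \<in> pverts G" using assms by (auto simp: weight_centers_def)
  obtain x y where xy: "x \<in> pverts G" "y \<in> pverts G" "x \<noteq> y"
    "int (f y) - int (f x) \<ge> lb G - 1 + int (gdist G x c) + int (gdist G y c)"
    using radio_labeling_ends[OF assms] by metis
  then have "gdist G x c > 0 \<or> gdist G y c > 0"
    using gdist_eq_0_iff cV by blast
  then show ?thesis
    using xy(4) radio_labeling_le_span[OF xy(2), of f] by linarith
qed

text \<open>Distinct multiples of \<open>diam G + 1\<close> are far enough apart for every pair.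
  Hence the minimum that defines \<open>rn\<close> is attained.\<close>

lemma radio_labeling_exists: "\<exists>f. radio_labeling G f"
proof -
  obtain h :: "'a \<Rightarrow> nat" where h: "inj_on h (pverts G)"
    using finite_imp_inj_to_nat_seg[OF pair_finite_verts] by auto
  have "radio_labeling G (\<lambda>v. h v * (diam G + 1))"
    unfolding radio_labeling_def
  proof (intro ballI impI)
    fix u v assume "u \<in> pverts G" "v \<in> pverts G" "u \<noteq> v"
    then have "\<bar>int (h u) - int (h v)\<bar> \<ge> 1"
      using inj_on_contraD[OF h] by (smt (verit) of_nat_eq_iff)
    then have "\<bar>int (h u) - int (h v)\<bar> * (int (diam G) + 1) \<ge> 1 * (int (diam G) + 1)"
      by (intro mult_right_mono) auto
    moreover have "int (h u * (diam G + 1)) - int (h v * (diam G + 1))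
        = (int (h u) - int (h v)) * (int (diam G) + 1)" by (simp add: algebra_simps)
    ultimately have "\<bar>int (h u * (diam G + 1)) - int (h v * (diam G + 1))\<bar> \<ge> int (diam G) + 1"
      by (simp add: abs_mult del: of_nat_mult of_nat_add)
    then show "int (diam G) + 1 - int (gdist G u v)
        \<le> \<bar>int (h u * (diam G + 1)) - int (h v * (diam G + 1))\<bar>"
      by (rule order_trans[rotated]) simp
  qed
  then show ?thesis by blast
qed

lemma rn_attained: obtains f where "radio_labeling G f" "span_of G f = rn G"
proof -
  have "\<exists>f. radio_labeling G f \<and> span_of G f = rn G"
    unfolding rn_def by (rule LeastI_ex) (use radio_labeling_exists in blast)
  then show ?thesis using that by blast
qed

text \<open>Reflection preserves label differences up to sign; the bound \<open>m\<close> keeps the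
  natural subtraction from truncating.\<close>

lemma radio_labeling_reflect:
  assumes "radio_labeling G f" "\<And>v. v \<in> pverts G \<Longrightarrow> f v \<le> m"
  shows "radio_labeling G (\<lambda>v. m - f v)"
  using assms unfolding radio_labeling_def
  by (auto simp: of_nat_diff abs_minus_commute)

text \<open>Knowing both ends is what allows labelings of several trees to be chained: each starts
  at the shared center and stops next to it.\<close>

lemma optimal_labeling:
  assumes "int (rn G) = lb G" "weight_centers G = {c}" "0 < diam G"
  obtains f x where "radio_labeling G f" "f c = 0" "x \<in> pverts G" "gdist G x c = 1"
    "f x = rn G" "\<And>v. v \<in> pverts G \<Longrightarrow> f v \<le> f x"
proof -
  have cV: "c \<in> pverts G" using assms by (auto simp: weight_centers_def)
  obtain f where f: "radio_labeling G f" "span_of G f = rn G" by (rule rn_attained)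
  obtain x y where xy: "x \<in> pverts G" "y \<in> pverts G" "x \<noteq> y"
    "\<And>z. z \<in> pverts G \<Longrightarrow> f x \<le> f z \<and> f z \<le> f y"
    "int (f y) - int (f x) \<ge> lb G - 1 + int (gdist G x c) + int (gdist G y c)"
    by (rule radio_labeling_ends[OF f(1) assms(2,3)]) (rule that)
  have "f y = rn G" using span_eqI[of y f] xy f(2) by simp
  moreover have "gdist G x c > 0 \<or> gdist G y c > 0"
    using gdist_eq_0_iff cV xy by blast
  \<comment> \<open>Since \<open>f y = lb G\<close>, the estimate for the ends says that
    \<open>f x\<close> plus the two levels is at most 1, and the levels use up that 1.\<close>
  ultimately have fx: "f x = 0" and "gdist G x c = 0 \<and> gdist G y c = 1 \<or> gdist G x c = 1 \<and> gdist G y c = 0"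
    using xy(5) assms(1) by linarith+
  then consider "x = c" "gdist G y c = 1" | "y = c" "gdist G x c = 1"
    using gdist_eq_0_iff cV xy by blast
  then show ?thesis
  proof cases
    case 1
    then show ?thesis using that[of f y] f fx \<open>f y = rn G\<close> xy by blast
  next
    case 2
    \<comment> \<open>The center comes last here, so the labeling is turned around.\<close>
    have "radio_labeling G (\<lambda>v. rn G - f v)"
      using radio_labeling_reflect f(1) xy(4) \<open>f y = rn G\<close> by simp
    then show ?thesis using that[of "\<lambda>v. rn G - f v" x] 2 fx \<open>f y = rn G\<close> xy by simp
  qed
qed

text \<open>
  An optimal labeling is adapted to a larger diameter \<open>D\<close> by widening every gap between
  consecutive labels by \<open>D - diam G\<close>.
\<close>

lemma stretched_labeling:
  assumes "int (rn G) = lb G" "weight_centers G = {c}" "0 < diam G" "diam G \<le> D"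
  obtains h x where "h c = 0" "x \<in> pverts G" "gdist G x c = 1"
    "h x = rn G + (card (pverts G) - 1) * (D - diam G)"
    "\<And>v. v \<in> pverts G \<Longrightarrow> h v \<le> h x"
    "\<And>u v. u \<in> pverts G \<Longrightarrow> v \<in> pverts G \<Longrightarrow> u \<noteq> v \<Longrightarrow>
       \<bar>int (h u) - int (h v)\<bar> \<ge> int D + 1 - int (gdist G u v)"
proof -
  obtain f x where f: "radio_labeling G f" "f c = 0" "x \<in> pverts G" "gdist G x c = 1"
    "f x = rn G" "\<And>v. v \<in> pverts G \<Longrightarrow> f v \<le> f x"
    using optimal_labeling[OF assms(1-3)] by blast
  \<comment> \<open>The rank of \<open>v\<close> in the order of labels, which is the number of
    widened gaps before \<open>v\<close>.\<close>
  define pos where "pos v = card {u \<in> pverts G. f u < f v}" for v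
  define h where "h v = f v + pos v * (D - diam G)" for v
  have inj: "f u \<noteq> f v" if "u \<in> pverts G" "v \<in> pverts G" "u \<noteq> v" for u v
    using f(1) gdist_le_diam[of u v] that by (force simp: radio_labeling_def)
  have pos_less: "pos u < pos v" if "u \<in> pverts G" "f u < f v" for u v
    unfolding pos_def using that pair_finite_verts by (intro psubset_card_mono) auto
  have "{u \<in> pverts G. f u < f x} = pverts G - {x}"
    using f(3,6) inj by (auto simp: order_less_le)
  then have posx: "pos x = card (pverts G) - 1"
    using f(3) pair_finite_verts by (simp add: pos_def)
  have gap: "int (h v) - int (h u) \<ge> int D + 1 - int (gdist G u v)"
    if "u \<in> pverts G" "v \<in> pverts G" "f u < f v" for u v
  proof -
    have "int (f v) - int (f u) \<ge> int (diam G) + 1 - int (gdist G u v)"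
      using radio_labelingD[OF f(1), of u v] that by auto
    \<comment> \<open>At least one widened gap lies between \<open>u\<close> and \<open>v\<close>;
      its \<open>D - diam G\<close> turns \<open>diam G + 1\<close> into
      \<open>D + 1\<close>.\<close>
    moreover have "Suc (pos u) * (D - diam G) \<le> pos v * (D - diam G)"
      using pos_less that by (intro mult_right_mono) (auto simp: Suc_le_eq)
    then have "pos u * (D - diam G) + (D - diam G) \<le> pos v * (D - diam G)"
      by simp
    moreover have "int (D - diam G) = int D - int (diam G)"
      using assms(4) by simp
    ultimately show ?thesis
      unfolding h_def of_nat_add by linarith
  qed
  show ?thesis
  proof (rule that[of h x])
    show "h c = 0" using f(2) by (simp add: h_def pos_def)
    show "h x = rn G + (card (pverts G) - 1) * (D - diam G)"
      by (simp add: h_def f(5) posx)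
    show "h v \<le> h x" if "v \<in> pverts G" for v
    proof -
      have "pos v \<le> pos x"
        unfolding pos_def using f(6)[OF that] pair_finite_verts by (intro card_mono) auto
      then show ?thesis using f(6)[OF that] by (simp add: h_def add_mono)
    qed
    show "\<bar>int (h u) - int (h v)\<bar> \<ge> int D + 1 - int (gdist G u v)"
      if "u \<in> pverts G" "v \<in> pverts G" "u \<noteq> v" for u v
      using gap[of u v] gap[of v u] inj[of u v] that gdist_commute[of u v]
      by (cases "f u < f v") auto
  qed (use f in auto)
qed

end

section \<open>Gluing at a vertex\<close>

text \<open>The retraction onto \<open>T i\<close> that collapses all other copies to the center. It
  serves to pull distances and cycles back to \<open>T i\<close>.\<close>

definition glue_proj :: "(nat \<Rightarrow> 'a) \<Rightarrow> nat \<Rightarrow> (nat \<times> 'a) option \<Rightarrow> 'a" where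
  "glue_proj w i x = (case x of None \<Rightarrow> w i | Some (j, v) \<Rightarrow> if j = i then v else w i)"

lemma glue_proj_None [simp]: "glue_proj w i None = w i"
  by (simp add: glue_proj_def)

lemma glue_proj_vertex [simp]: "glue_proj w i (glue_vertex w i v) = v"
  by (simp add: glue_proj_def glue_vertex_def)

lemma glue_proj_vertex_other [simp]: "i \<noteq> j \<Longrightarrow> glue_proj w i (glue_vertex w j v) = w i"
  by (simp add: glue_proj_def glue_vertex_def)

lemma glue_vertex_center [simp]: "glue_vertex w i (w i) = None"
  by (simp add: glue_vertex_def)

lemma glue_vertex_eq_None_iff [simp]: "glue_vertex w i v = None \<longleftrightarrow> v = w i"
  by (simp add: glue_vertex_def)

lemma glue_vertex_eq_iff [simp]: "glue_vertex w i u = glue_vertex w i v \<longleftrightarrow> u = v"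
  by (metis glue_proj_vertex)

lemma inj_glue_vertex: "inj_on (glue_vertex w i) A"
  by (rule inj_onI) simp

lemma glue_vertex_eq_indexD:
  "glue_vertex w i u = glue_vertex w j v \<Longrightarrow> u \<noteq> w i \<Longrightarrow> i = j"
  by (auto simp: glue_vertex_def split: if_splits)

lemma pcas_append: "pcas u (p @ q) v \<longleftrightarrow> (\<exists>x. pcas u p x \<and> pcas x q v)"
  by (induction p arbitrary: u) auto

lemma pcas_last: "pcas u p v \<Longrightarrow> p \<noteq> [] \<Longrightarrow> snd (last p) = v"
  by (induction p arbitrary: u) (auto split: if_splits)

text \<open>The vertices of a walk after the first are the heads of its arcs, so being a cycle can
  be stated on the arc list alone.\<close>

lemma cycle_iff:
  assumes "pair_wf_digraph G"
  shows "pre_digraph.cycle (with_proj G) p \<longleftrightarrow>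
    (\<exists>u. u \<in> pverts G \<and> set p \<subseteq> parcs G \<and> pcas u p u \<and> distinct (map snd p) \<and> p \<noteq> [])"
proof -
  interpret pair_wf_digraph G by fact
  have "tl (pawalk_verts u p) = map snd p" if "pcas u p v" for u v
    using awalk_verts_conv'[OF that] by simp
  then show ?thesis
    unfolding cycle_def awalk_def by (intro ex_cong1) auto
qed

locale wedge =
  fixes k :: nat and T :: "nat \<Rightarrow> 'a pair_pre_digraph" and w :: "nat \<Rightarrow> 'a"
  assumes k_pos: "1 \<le> k"
    and tree: "i \<in> {1..k} \<Longrightarrow> graph_tree (T i)"
    and center: "i \<in> {1..k} \<Longrightarrow> w i \<in> pverts (T i)"
begin

abbreviation "W \<equiv> glue k T w"
abbreviation "\<iota> \<equiv> glue_vertex w"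
abbreviation "\<pi> \<equiv> glue_proj w"

lemma conn_graph_T: "i \<in> {1..k} \<Longrightarrow> conn_graph (T i)"
  using tree graph_tree_conn_graph by blast

lemma glue_vertsI: "i \<in> {1..k} \<Longrightarrow> v \<in> pverts (T i) \<Longrightarrow> \<iota> i v \<in> pverts W"
  by (auto simp: glue_def)

lemma glue_vertsE:
  assumes "x \<in> pverts W"
  obtains i v where "i \<in> {1..k}" "v \<in> pverts (T i)" "x = \<iota> i v"
  using assms by (auto simp: glue_def)

lemma None_in_glue: "None \<in> pverts W"
  using glue_vertsI[of 1 "w 1"] center[of 1] k_pos by simp

lemma glue_arcsI: "i \<in> {1..k} \<Longrightarrow> (u, v) \<in> parcs (T i) \<Longrightarrow> (\<iota> i u, \<iota> i v) \<in> parcs W"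
  by (force simp: glue_def)

lemma glue_arcsE:
  assumes "(x, y) \<in> parcs W"
  obtains i u v where "i \<in> {1..k}" "(u, v) \<in> parcs (T i)" "x = \<iota> i u" "y = \<iota> i v"
  using assms by (auto simp: glue_def)

section \<open>The glued graph is simple and connected\<close>

lemma pair_graph_glue: "pair_graph W"
proof unfold_locales
  fix e assume e: "e \<in> parcs W"
  obtain x y where xy: "e = (x, y)" by force
  then obtain i u v where i: "i \<in> {1..k}" "(u, v) \<in> parcs (T i)" "x = \<iota> i u" "y = \<iota> i v"
    using e glue_arcsE by metis
  interpret Ti: conn_graph "T i" using conn_graph_T i by simp
  show "fst e \<in> pverts W" "snd e \<in> pverts W"
    using xy i glue_vertsI Ti.in_arcsD1 Ti.in_arcsD2 by auto
  show "fst e \<noteq> snd e"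
    using Ti.pair_no_loops[OF i(2)] xy i by simp
next
  have "finite (pverts (T i)) \<and> finite (parcs (T i))" if "i \<in> {1..k}" for i
  proof -
    interpret Ti: conn_graph "T i" using conn_graph_T that by simp
    show ?thesis using Ti.pair_finite_verts Ti.pair_finite_arcs by blast
  qed
  then show "finite (pverts W)" "finite (parcs W)"
    by (auto simp: glue_def)
  show "symmetric (with_proj W)"
    unfolding symmetric_def
  proof (rule symI)
    fix x y assume "(x, y) \<in> arcs_ends (with_proj W)"
    then obtain i u v where i: "i \<in> {1..k}" "(u, v) \<in> parcs (T i)" "x = \<iota> i u" "y = \<iota> i v"
      using glue_arcsE[of x y] by auto
    interpret Ti: conn_graph "T i" using conn_graph_T i by simp
    show "(y, x) \<in> arcs_ends (with_proj W)"
      using i Ti.sym_parcs glue_arcsI by (auto dest: symD)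
  qed
qed

lemma glue_relpow:
  "i \<in> {1..k} \<Longrightarrow> (u, v) \<in> parcs (T i) ^^ m \<Longrightarrow> (\<iota> i u, \<iota> i v) \<in> parcs W ^^ m"
proof (induction m arbitrary: v)
  case (Suc m)
  then show ?case using glue_arcsI by (meson relpow_Suc_E relpow_Suc_I)
qed simp

text \<open>Every vertex reaches \<open>None\<close> inside its own copy, and symmetry reverses such
  walks.\<close>

lemma conn_graph_glue: "conn_graph W"
proof -
  interpret pair_graph W by (rule pair_graph_glue)
  have symW: "sym (parcs W)" using pair_sym_arcs by (simp add: symmetric_def)
  have to_None: "(\<iota> i u, None) \<in> (parcs W)\<^sup>*" if i: "i \<in> {1..k}" "u \<in> pverts (T i)" for i u
  proof -
    interpret Ti: conn_graph "T i" using conn_graph_T i by simp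
    have "(\<iota> i u, \<iota> i (w i)) \<in> parcs W ^^ gdist (T i) u (w i)"
      using glue_relpow Ti.relpow_gdist center i by blast
    then show ?thesis using relpow_imp_rtrancl by fastforce
  qed
  have "(x, y) \<in> rtrancl_on (pverts W) ((parcs W)\<^sup>s)" if "x \<in> pverts W" "y \<in> pverts W" for x y
  proof -
    have "(x, None) \<in> (parcs W)\<^sup>*" "(y, None) \<in> (parcs W)\<^sup>*"
      using to_None that glue_vertsE by metis+
    then have "(x, y) \<in> (parcs W)\<^sup>*"
      using sym_rtrancl[OF symW] by (meson rtrancl_trans symD)
    \<comment> \<open>\<open>connected_conv\<close> asks for a closure restricted to the vertex set,
      so the walk is rebuilt arc by arc.\<close>
    then show ?thesis
    proof (induction rule: rtrancl_induct)
      case base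
      then show ?case using that by (simp add: rtrancl_on_refl)
    next
      case (step y z)
      have yz: "(y, z) \<in> (parcs W)\<^sup>s" using step(2) by (simp add: symcl_def)
      show ?case
        by (rule rtrancl_on_into_rtrancl_on[OF step(3) yz in_arcsD2[OF step(2)]])
    qed
  qed
  then show ?thesis
    using None_in_glue by unfold_locales (auto simp: connected_conv)
qed

sublocale glue: conn_graph W
  by (rule conn_graph_glue)

text \<open>
  Distances in the glued graph are bounded below by potentials that change by at most 1 along
  each arc: an arc lies in a single \<open>T l\<close>, so it moves only one of the projections \<open>\<pi> l\<close>.
\<close>

lemma gdist_glue_le:
  assumes "i \<in> {1..k}" "u \<in> pverts (T i)" "v \<in> pverts (T i)"
  shows "gdist W (\<iota> i u) (\<iota> i v) \<le> gdist (T i) u v"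
  using assms glue_vertsI glue_relpow conn_graph.relpow_gdist[OF conn_graph_T]
  by (intro glue.gdist_le) auto

lemma gdist_glue_step:
  assumes "(y, z) \<in> parcs W" "i \<in> {1..k}" "u \<in> pverts (T i)"
  shows "gdist (T i) u (\<pi> i z) \<le> Suc (gdist (T i) u (\<pi> i y))"
  using assms conn_graph.gdist_arc_step[OF conn_graph_T]
  by (auto elim!: glue_arcsE) (metis glue_proj_vertex glue_proj_vertex_other le_SucI order_refl)

lemma gdist_glue_same:
  assumes "i \<in> {1..k}" "u \<in> pverts (T i)" "v \<in> pverts (T i)"
  shows "gdist W (\<iota> i u) (\<iota> i v) = gdist (T i) u v"
proof (rule antisym)
  show "gdist (T i) u v \<le> gdist W (\<iota> i u) (\<iota> i v)"
    using glue.potential_le_gdist[of "\<iota> i u" "\<iota> i v" "\<lambda>z. gdist (T i) u (\<pi> i z)"]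
      assms glue_vertsI gdist_glue_step conn_graph.gdist_refl[OF conn_graph_T] by simp
qed (rule gdist_glue_le[OF assms])

lemma gdist_glue_diff:
  assumes "i \<in> {1..k}" "j \<in> {1..k}" "i \<noteq> j" "u \<in> pverts (T i)" "v \<in> pverts (T j)"
  shows "gdist W (\<iota> i u) (\<iota> j v) = gdist (T i) u (w i) + gdist (T j) (w j) v"
proof (rule antisym)
  show "gdist W (\<iota> i u) (\<iota> j v) \<le> gdist (T i) u (w i) + gdist (T j) (w j) v"
    using glue.gdist_triangle[of "\<iota> i u" None "\<iota> j v"] None_in_glue glue_vertsI assms
      gdist_glue_le[of i u "w i"] gdist_glue_le[of j "w j" v] center by fastforce
  have "gdist (T i) u (\<pi> i z) + gdist (T j) (w j) (\<pi> j z) \<le>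
      Suc (gdist (T i) u (\<pi> i y) + gdist (T j) (w j) (\<pi> j y))" if yz: "(y, z) \<in> parcs W" for y z
  proof -
    obtain l a b where "y = \<iota> l a" "z = \<iota> l b" using yz by (blast elim: glue_arcsE)
    then have "\<pi> i y = \<pi> i z \<or> \<pi> j y = \<pi> j z" using assms(3) by (cases "l = i") auto
    then show ?thesis
      using gdist_glue_step[OF yz, of i u] gdist_glue_step[OF yz, of j "w j"] assms center
      by auto
  qed
  then show "gdist (T i) u (w i) + gdist (T j) (w j) v \<le> gdist W (\<iota> i u) (\<iota> j v)"
    \<comment> \<open>The sum vanishes at \<open>\<iota> i u\<close>, whose projections are
      \<open>u\<close> and \<open>w j\<close>; at \<open>\<iota> j v\<close> the projections are
      \<open>w i\<close> and \<open>v\<close>.\<close>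
    using glue.potential_le_gdist[of "\<iota> i u" "\<iota> j v"
        "\<lambda>z. gdist (T i) u (\<pi> i z) + gdist (T j) (w j) (\<pi> j z)"]
      assms glue_vertsI center conn_graph.gdist_refl[OF conn_graph_T] by simp
qed

lemma gdist_glue_center:
  assumes "i \<in> {1..k}" "v \<in> pverts (T i)"
  shows "gdist W (\<iota> i v) None = gdist (T i) v (w i)"
  using gdist_glue_same[OF assms center[OF assms(1)]] by simp

lemma diam_le_diam_glue:
  assumes "i \<in> {1..k}"
  shows "diam (T i) \<le> diam W"
proof -
  interpret Ti: conn_graph "T i" using conn_graph_T assms by simp
  obtain u v where "u \<in> pverts (T i)" "v \<in> pverts (T i)" "gdist (T i) u v = diam (T i)"
    by (rule Ti.diam_attained)
  then show ?thesis
    using gdist_glue_same glue_vertsI glue.gdist_le_diam assms by metis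
qed

text \<open>Copies can be switched only at \<open>None\<close>. Using \<open>butlast\<close> bars
  \<open>None\<close> as an intermediate vertex but lets the walk end there.\<close>

lemma pcas_glue_class:
  assumes "pcas (\<iota> i u) q y" "u \<noteq> w i" "set q \<subseteq> parcs W" "None \<notin> snd ` set (butlast q)"
  shows "set q \<subseteq> map_prod (\<iota> i) (\<iota> i) ` parcs (T i) \<and> (q \<noteq> [] \<longrightarrow> i \<in> {1..k})"
  using assms
proof (induction q arbitrary: u)
  case (Cons e q)
  obtain z where e: "e = (\<iota> i u, z)" using Cons.prems(1) by (cases e) auto
  then obtain j a b where j: "j \<in> {1..k}" "(a, b) \<in> parcs (T j)" "\<iota> i u = \<iota> j a" "z = \<iota> j b"
    using Cons.prems(3) glue_arcsE[of "\<iota> i u" z] by auto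
  have "j = i" using glue_vertex_eq_indexD[OF j(3) Cons.prems(2)] by simp
  then have eT: "e \<in> map_prod (\<iota> i) (\<iota> i) ` parcs (T i)" "i \<in> {1..k}"
    using e j by force+
  show ?case
  proof (cases "q = []")
    case True
    then show ?thesis using eT by simp
  next
    case False
    then have "b \<noteq> w i" using Cons.prems(4) e j \<open>j = i\<close> by auto
    moreover have "pcas (\<iota> i b) q y" using Cons.prems(1) e j \<open>j = i\<close> by simp
    ultimately show ?thesis
      using Cons.IH[of b] Cons.prems False eT by auto
  qed
qed simp

text \<open>
  A cycle passes through the cut vertex at most once, so after rotation it starts there and
  can never leave the copy of \<open>T i\<close> that its first arc belongs to.
\<close>

lemma glue_cycle_class:
  assumes "pcas x p x" "p \<noteq> []" "set p \<subseteq> parcs W" "distinct (map snd p)"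
  obtains i where "i \<in> {1..k}" "set p \<subseteq> map_prod (\<iota> i) (\<iota> i) ` parcs (T i)"
proof (cases "None \<in> snd ` set p")
  case False
  obtain e p' where p: "p = e # p'" using assms(2) by (cases p) auto
  then obtain y where e: "e = (x, y)" using assms(1) by (cases e) auto
  then obtain i u where i: "x = \<iota> i u" using assms(3) p by (auto elim: glue_arcsE)
  \<comment> \<open>The start of a closed walk is also the head of its last arc.\<close>
  have "x \<noteq> None"
    using pcas_last[OF assms(1,2)] False assms(2) by (metis image_eqI last_in_set)
  moreover have "None \<notin> snd ` set (butlast p)"
    using False by (auto dest: in_set_butlastD)
  ultimately have "set p \<subseteq> map_prod (\<iota> i) (\<iota> i) ` parcs (T i)" "i \<in> {1..k}"
    using pcas_glue_class[of i u p x] assms i by auto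
  then show ?thesis using that by blast
next
  case True
  then obtain e where e: "e \<in> set p" "snd e = None" by force
  then obtain p1 p2 where p: "p = p1 @ e # p2" by (meson split_list)
  \<comment> \<open>The rotation that makes \<open>e\<close>, the arc into \<open>None\<close>, the
    last one.\<close>
  define q where "q = p2 @ p1 @ [e]"
  have q: "pcas None q None" "set q = set p" "distinct (map snd q)"
    using assms(1,4) e p by (auto simp: q_def pcas_append simp del: glue.cas_append_iff)
  obtain e' q' where q': "q = e' # q'" by (cases q) (auto simp: q_def)
  then obtain y where e': "e' = (None, y)" using q(1) by (cases e') auto
  then have arc: "(None, y) \<in> parcs W" using q' q(2) assms(3) by auto
  then obtain i u v where i: "i \<in> {1..k}" "(u, v) \<in> parcs (T i)" "None = \<iota> i u" "y = \<iota> i v"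
    using glue_arcsE by metis
  have "y \<noteq> None" using glue.pair_no_loops[OF arc] by simp
  have "None \<notin> snd ` set (butlast q)"
  proof -
    have "butlast q = p2 @ p1" by (simp add: q_def butlast_append)
    then show ?thesis using q(3) e(2) by (auto simp: q_def image_iff)
  qed
  then have "None \<notin> snd ` set (butlast q')"
    using q' by (auto split: if_splits)
  then have "set q' \<subseteq> map_prod (\<iota> i) (\<iota> i) ` parcs (T i)"
    using pcas_glue_class[of i v q' None] q q' e' i \<open>y \<noteq> None\<close> assms(3) by auto
  moreover have "e' \<in> map_prod (\<iota> i) (\<iota> i) ` parcs (T i)"
    using e' i by force
  moreover have "set p = insert e' (set q')" using q(2) q' by simp
  ultimately have "set p \<subseteq> map_prod (\<iota> i) (\<iota> i) ` parcs (T i)" by simp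
  then show ?thesis by (rule that[OF i(1)])
qed

text \<open>A cycle stays in one copy, where \<open>\<pi> i\<close> is injective, so its projection
  is a cycle of the same length in \<open>T i\<close>.\<close>

lemma graph_tree_glue: "graph_tree W"
proof -
  have False if cyc: "pre_digraph.cycle (with_proj W) p" and len: "3 \<le> length p" for p
  proof -
    obtain x where x: "set p \<subseteq> parcs W" "pcas x p x" "distinct (map snd p)" "p \<noteq> []"
      using cyc cycle_iff glue.pair_wf_digraph_axioms by blast
    obtain i where i: "i \<in> {1..k}" and p: "set p \<subseteq> map_prod (\<iota> i) (\<iota> i) ` parcs (T i)"
      using glue_cycle_class x by metis
    interpret Ti: conn_graph "T i" using conn_graph_T i by simp
    define p' where "p' = map (map_prod (\<pi> i) (\<pi> i)) p"
    have "set p' \<subseteq> parcs (T i)"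
      using p by (auto simp: p'_def)
    moreover have "pcas (\<pi> i y) (map (map_prod (\<pi> i) (\<pi> i)) q) (\<pi> i z)" if "pcas y q z" for y q z
      using that by (induction q arbitrary: y) auto
    then have "pcas (\<pi> i x) p' (\<pi> i x)" using x by (simp add: p'_def)
    moreover have "distinct (map snd p')"
    proof -
      have "map snd p' = map (\<pi> i) (map snd p)" by (simp add: p'_def)
      moreover have "inj_on (\<pi> i) (set (map snd p))"
        by (rule inj_on_inverseI[where g = "\<iota> i"]) (use p in auto)
      ultimately show ?thesis using x(3) by (simp only: distinct_map)
    qed
    moreover have "p' \<noteq> []" "3 \<le> length p'" using x len by (auto simp: p'_def)
    moreover have "\<pi> i x \<in> pverts (T i)"
      using calculation Ti.in_arcsD1 by (cases p') auto
    ultimately have "pre_digraph.cycle (with_proj (T i)) p'"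
      using cycle_iff[OF Ti.pair_wf_digraph_axioms] by blast
    then show False
      using tree[OF i] \<open>3 \<le> length p'\<close> unfolding graph_tree_def by blast
  qed
  then show ?thesis
    unfolding graph_tree_def using pair_graph_glue glue.conn by blast
qed

end

section \<open>The labeling of the glued tree\<close>

text \<open>Writes the order minus one as a sum vanishing at one vertex, the form that can be split
  over the copies.\<close>

lemma sum_except_one:
  assumes "finite A" "c \<in> A"
  shows "(\<Sum>x\<in>A. if x = c then 0 else 1 :: int) = int (card A) - 1"
proof -
  have "(\<Sum>x\<in>A. if x = c then 0 else 1 :: int) = (\<Sum>x\<in>A - {c}. if x = c then 0 else 1)"
    using assms by (simp add: sum.remove[of A c])
  also have "\<dots> = (\<Sum>x\<in>A - {c}. 1)"
    by (rule sum.cong) auto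
  also have "\<dots> = int (card A) - 1"
    using assms card_gt_0_iff[of A] by (auto simp: of_nat_diff Suc_le_eq)
  finally show ?thesis .
qed

context wedge
begin

lemma finite_pverts_T: "i \<in> {1..k} \<Longrightarrow> finite (pverts (T i))"
proof -
  assume "i \<in> {1..k}"
  then interpret Ti: conn_graph "T i" by (rule conn_graph_T)
  show ?thesis by (rule Ti.pair_finite_verts)
qed

text \<open>Away from \<open>None\<close> the copies are disjoint. The shared vertex would be
  counted \<open>k\<close> times on the right, hence the condition on \<open>F None\<close>.\<close>

lemma sum_pverts_glue:
  fixes F :: "(nat \<times> 'a) option \<Rightarrow> 'b::comm_monoid_add"
  assumes "F None = 0"
  shows "(\<Sum>x\<in>pverts W. F x) = (\<Sum>i=1..k. \<Sum>v\<in>pverts (T i). F (\<iota> i v))"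
proof -
  let ?B = "\<lambda>i. \<iota> i ` (pverts (T i) - {w i})"
  have V: "pverts W - {None} = (\<Union>i\<in>{1..k}. ?B i)"
  proof
    show "pverts W - {None} \<subseteq> (\<Union>i\<in>{1..k}. ?B i)"
    proof
      fix x assume x: "x \<in> pverts W - {None}"
      then have "x \<in> pverts W" by simp
      then obtain i v where "i \<in> {1..k}" "v \<in> pverts (T i)" "x = \<iota> i v"
        by (rule glue_vertsE)
      with x show "x \<in> (\<Union>i\<in>{1..k}. ?B i)" by fastforce
    qed
    show "(\<Union>i\<in>{1..k}. ?B i) \<subseteq> pverts W - {None}"
      using glue_vertsI by auto
  qed
  have "(\<Sum>x\<in>pverts W. F x) = (\<Sum>x\<in>pverts W - {None}. F x)"
    using assms None_in_glue glue.pair_finite_verts by (simp add: sum.remove[of _ None])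
  also have "\<dots> = (\<Sum>i=1..k. \<Sum>x\<in>?B i. F x)"
    unfolding V
  proof (rule sum.UNION_disjoint)
    show "\<forall>i\<in>{1..k}. finite (?B i)" using finite_pverts_T by simp
    show "\<forall>i\<in>{1..k}. \<forall>j\<in>{1..k}. i \<noteq> j \<longrightarrow> ?B i \<inter> ?B j = {}"
      using glue_vertex_eq_indexD by fastforce
  qed simp
  also have "\<dots> = (\<Sum>i=1..k. \<Sum>v\<in>pverts (T i). F (\<iota> i v))"
  proof (rule sum.cong)
    fix i assume i: "i \<in> {1..k}"
    have "(\<Sum>x\<in>?B i. F x) = (\<Sum>v\<in>pverts (T i) - {w i}. F (\<iota> i v))"
      by (simp add: sum.reindex inj_glue_vertex)
    also have "\<dots> = (\<Sum>v\<in>pverts (T i). F (\<iota> i v))"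
      using assms center[OF i] finite_pverts_T[OF i] by (simp add: sum.remove[of _ "w i"])
    finally show "(\<Sum>x\<in>?B i. F x) = (\<Sum>v\<in>pverts (T i). F (\<iota> i v))" .
  qed simp
  finally show ?thesis .
qed

lemma card_pverts_glue: "int (card (pverts W)) - 1 = (\<Sum>i=1..k. int (card (pverts (T i))) - 1)"
proof -
  have "int (card (pverts W)) - 1 = (\<Sum>x\<in>pverts W. if x = None then 0 else 1)"
    using None_in_glue glue.pair_finite_verts by (rule sum_except_one[symmetric, rotated])
  also have "\<dots> = (\<Sum>i=1..k. \<Sum>v\<in>pverts (T i). if v = w i then 0 else 1)"
    by (subst sum_pverts_glue) simp_all
  also have "\<dots> = (\<Sum>i=1..k. int (card (pverts (T i))) - 1)"
    using finite_pverts_T center by (intro sum.cong) (simp_all add: sum_except_one)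
  finally show ?thesis .
qed

text \<open>Moving from \<open>None\<close> to \<open>u\<close> raises the weight strictly inside
  the copy of \<open>T i\<close>, where \<open>w i\<close> is the only minimizer, and lowers no
  distance to a vertex outside it.\<close>

lemma weight_glue_less:
  assumes i: "i \<in> {1..k}" and c: "weight_centers (T i) = {w i}"
    and u: "u \<in> pverts (T i)" "u \<noteq> w i"
  shows "weight W None < weight W (\<iota> i u)"
proof -
  let ?A = "\<iota> i ` pverts (T i)"
  have A: "?A \<subseteq> pverts W" using i glue_vertsI by auto
  have split: "weight W x = (\<Sum>y\<in>pverts W - ?A. gdist W y x) + (\<Sum>v\<in>pverts (T i). gdist W (\<iota> i v) x)" for x
    unfolding weight_def sum.subset_diff[OF A glue.pair_finite_verts]
    by (simp add: sum.reindex inj_glue_vertex)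
  have "weight (T i) (w i) < weight (T i) u"
  proof (rule ccontr)
    assume "\<not> ?thesis"
    moreover have "weight (T i) (w i) \<le> weight (T i) v" if "v \<in> pverts (T i)" for v
      using c that by (auto simp: weight_centers_def)
    ultimately have "u \<in> weight_centers (T i)"
      using u(1) unfolding weight_centers_def by (auto simp: not_less intro: order_trans)
    then show False using c u(2) by simp
  qed
  moreover have "(\<Sum>v\<in>pverts (T i). gdist W (\<iota> i v) None) = weight (T i) (w i)"
    unfolding weight_def using i by (intro sum.cong) (simp_all add: gdist_glue_center)
  moreover have "(\<Sum>v\<in>pverts (T i). gdist W (\<iota> i v) (\<iota> i u)) = weight (T i) u"
    unfolding weight_def using i u by (intro sum.cong) (simp_all add: gdist_glue_same)
  moreover have "(\<Sum>y\<in>pverts W - ?A. gdist W y None) \<le> (\<Sum>y\<in>pverts W - ?A. gdist W y (\<iota> i u))"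
  proof (rule sum_mono)
    fix y assume y: "y \<in> pverts W - ?A"
    then obtain j v where j: "j \<in> {1..k}" "v \<in> pverts (T j)" "y = \<iota> j v"
      by (auto elim: glue_vertsE)
    then have "j \<noteq> i" using y by auto
    then show "gdist W y None \<le> gdist W y (\<iota> i u)"
      using j i u by (simp add: gdist_glue_center gdist_glue_diff)
  qed
  ultimately show ?thesis by (simp add: split)
qed

lemma weight_centers_glue:
  assumes "\<And>i. i \<in> {1..k} \<Longrightarrow> weight_centers (T i) = {w i}"
  shows "weight_centers W = {None}"
proof -
  have less: "weight W None < weight W x" if "x \<in> pverts W" "x \<noteq> None" for x
  proof -
    obtain i u where i: "i \<in> {1..k}" "u \<in> pverts (T i)" "x = \<iota> i u"
      using \<open>x \<in> pverts W\<close> by (rule glue_vertsE)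
    then show ?thesis
      using \<open>x \<noteq> None\<close> weight_glue_less[OF i(1) assms[OF i(1)] i(2)] by simp
  qed
  then have "weight W None \<le> weight W x" if "x \<in> pverts W" for x
    using that by (cases "x = None") (auto intro: less_imp_le)
  then show ?thesis
    using less None_in_glue unfolding weight_centers_def by (fastforce dest: leD)
qed

text \<open>Orders minus one and total levels add up over the copies. Each \<open>lb (T i)\<close>
  brings a final \<open>eps\<close> of 1 while \<open>lb W\<close> has just one, whence
  \<open>- k + 1\<close>.\<close>

lemma lb_glue:
  assumes c: "\<And>i. i \<in> {1..k} \<Longrightarrow> weight_centers (T i) = {w i}"
  shows "lb W = (\<Sum>i=1..k. lb (T i) + (int (card (pverts (T i))) - 1) * (int (diam W) - int (diam (T i))))
    - int k + 1"
proof -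
  let ?n = "\<lambda>i. int (card (pverts (T i)))" and ?L = "\<lambda>i. \<Sum>u\<in>pverts (T i). int (gdist (T i) u (w i))"
  have wc: "weight_centers W = {None}" using c by (rule weight_centers_glue)
  have "(\<Sum>x\<in>pverts W. int (gdist W x None)) =
      (\<Sum>i=1..k. \<Sum>v\<in>pverts (T i). int (gdist W (\<iota> i v) None))"
    by (rule sum_pverts_glue) (simp add: None_in_glue)
  also have "\<dots> = (\<Sum>i=1..k. ?L i)"
    by (intro sum.cong refl) (simp add: gdist_glue_center)
  finally have "lb W = (\<Sum>i=1..k. ?n i - 1) * (int (diam W) + 1) - 2 * (\<Sum>i=1..k. ?L i) + 1"
    unfolding lb_unique_center[OF wc] card_pverts_glue by simp
  also have "\<dots> = (\<Sum>i=1..k. (?n i - 1) * (int (diam W) + 1) - 2 * ?L i) + 1"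
    by (simp only: sum_subtractf[of "\<lambda>i. (?n i - 1) * (int (diam W) + 1)"]
        sum_distrib_right[symmetric] sum_distrib_left[symmetric])
  also have "(\<Sum>i=1..k. (?n i - 1) * (int (diam W) + 1) - 2 * ?L i) =
      (\<Sum>i=1..k. lb (T i) + (?n i - 1) * (int (diam W) - int (diam (T i))) - 1)"
    by (intro sum.cong) (simp_all add: lb_unique_center[OF c] algebra_simps)
  also have "\<dots> = (\<Sum>i=1..k. lb (T i) + (?n i - 1) * (int (diam W) - int (diam (T i)))) - int k"
    by (simp add: sum_subtractf)
  finally show ?thesis by simp
qed

lemma glue_labeling:
  assumes lbt: "\<And>i. i \<in> {1..k} \<Longrightarrow> T i \<in> lower_bound_trees"
    and c: "\<And>i. i \<in> {1..k} \<Longrightarrow> weight_centers (T i) = {w i}"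
  obtains F where "radio_labeling W F" "int (span_of W F) = lb W"
proof -
  let ?D = "diam W"
  \<comment> \<open>Bundles the conclusions of \<open>stretched_labeling\<close> so that labelings
    and last vertices can be chosen for all \<open>i\<close> at once.\<close>
  define P where "P i h x \<longleftrightarrow> h (w i) = 0 \<and> x \<in> pverts (T i) \<and> gdist (T i) x (w i) = 1 \<and>
      h x = rn (T i) + (card (pverts (T i)) - 1) * (?D - diam (T i)) \<and>
      (\<forall>v\<in>pverts (T i). h v \<le> h x) \<and>
      (\<forall>u\<in>pverts (T i). \<forall>v\<in>pverts (T i). u \<noteq> v \<longrightarrow>
        \<bar>int (h u) - int (h v)\<bar> \<ge> int ?D + 1 - int (gdist (T i) u v))" for i and h :: "'a \<Rightarrow> nat" and x
  have "\<exists>h x. P i h x" if i: "i \<in> {1..k}" for i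
  proof -
    interpret Ti: conn_graph "T i" using conn_graph_T i by simp
    have "int (rn (T i)) = lb (T i)" "0 < diam (T i)"
      using lbt[OF i] by (auto simp: lower_bound_trees_def)
    then show ?thesis
      using Ti.stretched_labeling[OF _ c[OF i] _ diam_le_diam_glue[OF i]] unfolding P_def by metis
  qed
  then obtain h X where "\<And>i. i \<in> {1..k} \<Longrightarrow> P i (h i) (X i)" by metis
  then have h0: "h i (w i) = 0" and X: "X i \<in> pverts (T i)" "gdist (T i) (X i) (w i) = 1"
    and hX: "h i (X i) = rn (T i) + (card (pverts (T i)) - 1) * (?D - diam (T i))"
    and hmax: "v \<in> pverts (T i) \<Longrightarrow> h i v \<le> h i (X i)"
    and gap: "u \<in> pverts (T i) \<Longrightarrow> v \<in> pverts (T i) \<Longrightarrow> u \<noteq> v \<Longrightarrow>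
        \<bar>int (h i u) - int (h i v)\<bar> \<ge> int ?D + 1 - int (gdist (T i) u v)"
    if "i \<in> {1..k}" for i u v
    using \<open>\<And>i. i \<in> {1..k} \<Longrightarrow> P i (h i) (X i)\<close>[OF that] unfolding P_def by blast+
  have D2: "2 \<le> ?D"
    using lbt[of 1] k_pos diam_le_diam_glue[of 1] by (auto simp: lower_bound_trees_def)
  have Xw: "X i \<noteq> w i" if "i \<in> {1..k}" for i
    using X[OF that] conn_graph.gdist_refl[OF conn_graph_T[OF that]] by auto
  have hw: "int (h i v) \<ge> int ?D + 1 - int (gdist (T i) v (w i))"
    if "i \<in> {1..k}" "v \<in> pverts (T i)" "v \<noteq> w i" for i v
    using gap[OF that(1,2) center[OF that(1)] that(3)] h0[OF that(1)] by simp
  \<comment> \<open>Ensures that the natural subtraction \<open>h j (X j) - 1\<close> in the offsets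
    below does not truncate.\<close>
  have R: "1 \<le> h i (X i)" if "i \<in> {1..k}" for i
    using hw[OF that X(1)[OF that] Xw[OF that]] X(2)[OF that] D2 by linarith
  \<comment> \<open>Consecutive blocks overlap by one because the last vertex of a block, being adjacent to
    the center, has level 1 where the center, the first vertex of \<open>T i\<close>, has level 0.\<close>
  define S where "S i = (\<Sum>j=1..<i. h j (X j) - 1)" for i
  have S_Suc: "int (S (Suc i)) = int (S i) + int (h i (X i)) - 1" if "i \<in> {1..k}" for i
    using that R[OF that] by (simp add: S_def of_nat_diff)
  have S_mono: "S i \<le> S j" if "i \<le> j" for i j
    unfolding S_def using that by (intro sum_mono2) auto
  \<comment> \<open>Only the noncentral vertices are shifted by the offset of their block; the
    shared center keeps label 0.\<close>
  define F where "F x = (case x of None \<Rightarrow> 0 | Some (i, v) \<Rightarrow> S i + h i v)" for x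
  have F_None: "F None = 0" by (simp add: F_def)
  have F_vertex: "F (\<iota> i v) = S i + h i v" if "v \<noteq> w i" for i v
    using that by (simp add: F_def glue_vertex_def)
  let ?ok = "\<lambda>x y. \<bar>int (F x) - int (F y)\<bar> \<ge> int ?D + 1 - int (gdist W x y)"
  have ok_commute: "?ok x y" if "?ok y x" "x \<in> pverts W" "y \<in> pverts W" for x y
    using that glue.gdist_commute[of x y] by (simp add: abs_minus_commute)
  have ok_None: "?ok (\<iota> i v) None" if "i \<in> {1..k}" "v \<in> pverts (T i)" "v \<noteq> w i" for i v
    using hw[OF that] that by (simp add: F_None F_vertex gdist_glue_center)
  have ok_less: "?ok (\<iota> i u) (\<iota> j v)"
    if i: "i \<in> {1..k}" "u \<in> pverts (T i)" "u \<noteq> w i"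
      and j: "j \<in> {1..k}" "v \<in> pverts (T j)" "v \<noteq> w j" and "i < j" for i j u v
  proof -
    \<comment> \<open>As \<open>X i\<close> is adjacent to the center, \<open>u\<close> is at most
      one step further from \<open>X i\<close> than from the center.\<close>
    have "int (h i (X i)) - int (h i u) \<ge> int ?D - int (gdist (T i) u (w i)) \<or> u = X i"
    proof (cases "u = X i")
      case False
      interpret Ti: conn_graph "T i" using conn_graph_T i by simp
      have "gdist (T i) u (X i) \<le> gdist (T i) u (w i) + 1"
        using Ti.gdist_triangle[of u "w i" "X i"] Ti.gdist_commute[of "w i" "X i"]
          X[OF i(1)] center[OF i(1)] i by simp
      then show ?thesis
        using gap[OF i(1,2) X(1)[OF i(1)] False] hmax[OF i(1,2)] by linarith
    qed simp
    moreover have "int (S i) + int (h i (X i)) - 1 \<le> int (S j)"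
      using S_Suc[OF i(1)] S_mono[of "Suc i" j] \<open>i < j\<close> by linarith
    moreover have "int (h j v) \<ge> int ?D + 1 - int (gdist (T j) v (w j))"
      using hw j by blast
    moreover have "gdist W (\<iota> i u) (\<iota> j v) = gdist (T i) u (w i) + gdist (T j) v (w j)"
      using gdist_glue_diff[of i j u v] conn_graph.gdist_commute[OF conn_graph_T[OF j(1)]]
        i j center \<open>i < j\<close> by simp
    \<comment> \<open>For \<open>u = X i\<close> the lost 1 is exactly the level of
      \<open>X i\<close>; otherwise the bounds give \<open>2 * ?D\<close> minus both levels, which
      is enough as \<open>?D\<close> is at least 1.\<close>
    ultimately have "int (F (\<iota> j v)) - int (F (\<iota> i u)) \<ge> int ?D + 1 - int (gdist W (\<iota> i u) (\<iota> j v))"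
      using X(2)[OF i(1)] D2 by (auto simp: F_vertex i j)
    then show ?thesis by linarith
  qed
  have "?ok x y" if xy: "x \<in> pverts W" "y \<in> pverts W" "x \<noteq> y" for x y
  proof -
    obtain i u where i: "i \<in> {1..k}" "u \<in> pverts (T i)" "x = \<iota> i u" using xy(1) by (rule glue_vertsE)
    obtain j v where j: "j \<in> {1..k}" "v \<in> pverts (T j)" "y = \<iota> j v" using xy(2) by (rule glue_vertsE)
    show ?thesis
    proof (cases "u = w i \<or> v = w j")
      case True
      then consider "x = None" "v \<noteq> w j" | "y = None" "u \<noteq> w i"
        using i(3) j(3) xy(3) glue_vertex_center by metis
      then show ?thesis
        using ok_None i j ok_commute xy by metis
    next
      case False
      consider "i < j" | "j < i" | "i = j" by linarith
      then show ?thesis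
      proof cases
        case 3
        then show ?thesis
          using False i j gap[of i u v] xy by (simp add: F_vertex gdist_glue_same)
      qed (use ok_less i j False ok_commute xy in blast)+
    qed
  qed
  then have radio: "radio_labeling W F"
    unfolding radio_labeling_def by blast
  have k: "k \<in> {1..k}" using k_pos by simp
  let ?x = "\<iota> k (X k)"
  \<comment> \<open>The offset \<open>S (Suc k)\<close> has subtracted 1 for the last block too,
    although no block follows; the \<open>+ 1\<close> restores it.\<close>
  have Fx: "int (F ?x) = int (S (Suc k)) + 1"
    using S_Suc[OF k] by (simp add: F_vertex Xw[OF k])
  have "F y \<le> F ?x" if "y \<in> pverts W" for y
  proof (cases "y = None")
    case False
    obtain i v where i: "i \<in> {1..k}" "v \<in> pverts (T i)" "y = \<iota> i v" using \<open>y \<in> pverts W\<close> by (rule glue_vertsE)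
    then have "int (F y) \<le> int (S (Suc i)) + 1"
      using S_Suc[OF i(1)] hmax[OF i(1,2)] False by (simp add: F_vertex)
    moreover have "S (Suc i) \<le> S (Suc k)" using S_mono i(1) by simp
    ultimately show ?thesis using Fx by linarith
  qed (simp add: F_None)
  then have "span_of W F = F ?x"
    using glue_vertsI[OF k X(1)[OF k]] by (intro glue.span_eqI)
  then have "int (span_of W F) = (\<Sum>i=1..k. int (h i (X i)) - 1) + 1"
  proof -
    have "int (S (Suc k)) = (\<Sum>i=1..k. int (h i (X i) - 1))"
      by (simp add: S_def atLeastLessThanSuc_atLeastAtMost)
    also have "\<dots> = (\<Sum>i=1..k. int (h i (X i)) - 1)"
      using R by (intro sum.cong) (auto simp: of_nat_diff)
    finally show ?thesis using Fx \<open>span_of W F = F ?x\<close> by simp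
  qed
  \<comment> \<open>Optimality of each \<open>T i\<close> replaces \<open>rn (T i)\<close> by
    \<open>lb (T i)\<close> in the stretched spans.\<close>
  also have "(\<Sum>i=1..k. int (h i (X i)) - 1) =
      (\<Sum>i=1..k. lb (T i) + (int (card (pverts (T i))) - 1) * (int ?D - int (diam (T i))) - 1)"
  proof (rule sum.cong)
    fix i assume i: "i \<in> {1..k}"
    have "card (pverts (T i)) \<ge> 1"
      using center[OF i] finite_pverts_T[OF i] by (auto simp: Suc_le_eq card_gt_0_iff)
    then show "int (h i (X i)) - 1 =
        lb (T i) + (int (card (pverts (T i))) - 1) * (int ?D - int (diam (T i))) - 1"
      using lbt[OF i] diam_le_diam_glue[OF i] hX[OF i]
      by (simp add: lower_bound_trees_def of_nat_diff)
  qed simp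
  also have "\<dots> + 1 = lb W"
    by (subst lb_glue) (use c in \<open>simp_all add: sum_subtractf\<close>)
  finally show ?thesis
    using that radio by blast
qed

end

theorem theorem3p2:
  fixes k :: nat
    and T :: "nat \<Rightarrow> 'a pair_pre_digraph"
    and w :: "nat \<Rightarrow> 'a"
  assumes "k \<ge> 2"
    and "\<And>i. i \<in> {1..k} \<Longrightarrow> T i \<in> lower_bound_trees"
    and "\<And>i. i \<in> {1..k} \<Longrightarrow> weight_centers (T i) = {w i}"
  shows "glue k T w \<in> lower_bound_trees \<and>
    int (rn (glue k T w)) =
      (\<Sum>i = 1..k. int (rn (T i)) +
          (int (card (pverts (T i))) - 1) * (int (diam (glue k T w)) - int (diam (T i))))
      - int k + 1"
proof -
  interpret wedge k T w
  proof
    show "1 \<le> k" using assms(1) by simp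
    show "graph_tree (T i)" if "i \<in> {1..k}" for i
      using assms(2)[OF that] by (simp add: lower_bound_trees_def)
    show "w i \<in> pverts (T i)" if "i \<in> {1..k}" for i
      using assms(3)[OF that] by (auto simp: weight_centers_def)
  qed
  have "2 \<le> diam W"
    using assms(2)[of 1] k_pos diam_le_diam_glue[of 1] by (auto simp: lower_bound_trees_def)
  obtain F where F: "radio_labeling W F" "int (span_of W F) = lb W"
    using glue_labeling assms(2,3) by blast
  \<comment> \<open>The span of \<open>F\<close> equals the bound that \<open>lb_le_span\<close>
    puts on every radio labeling of the glued tree.\<close>
  have "rn W = span_of W F"
  proof (rule rn_eqI[OF F(1) refl])
    fix g assume "radio_labeling W g"
    then have "lb W \<le> int (span_of W g)"
      using glue.lb_le_span weight_centers_glue assms(3) \<open>2 \<le> diam W\<close> by fastforce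
    then show "span_of W F \<le> span_of W g" using F(2) by simp
  qed
  then have "int (rn W) = lb W" using F(2) by simp
  moreover have "lb W = (\<Sum>i = 1..k. int (rn (T i)) +
      (int (card (pverts (T i))) - 1) * (int (diam W) - int (diam (T i)))) - int k + 1"
    using lb_glue[OF assms(3)] assms(2) by (simp add: lower_bound_trees_def)
  ultimately show ?thesis
    using graph_tree_glue \<open>2 \<le> diam W\<close> by (simp add: lower_bound_trees_def)
qed

end
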